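(* Let $G$ be a simple connected graph with adjacency matrix $A$ and let $k$ be a positive integer. Then $$\alpha_k(G)=\alpha(G^k)\le\Theta(G^k)\le \min_{\substack{p\in\mathbb R_k[x]\\ (p(A))_{ii}\neq 0\ \forall i}}\operatorname{rank}(p(A)).$$
   Context: $\mathbb R_k[x]$ is the set of real polynomials of degree at most $k$. $G^k$ has the vertex set of $G$, two distinct vertices adjacent iff their distance in $G$ is at most $k$. $\alpha$ is the independence number; $\alpha_k(G)$ is the maximum number of vertices pairwise at distance greater than $k$ in $G$. $\Theta(H)=\sup_m\alpha(H^{\boxtimes m})^{1/m}$ is the Shannon capacity, with $H^{\boxtimes m}$ the $m$-fold strong product. *)

theory Defs
  imports
    "HOL-Analysis.Analysis"
    "HOL-Computational_Algebra.Polynomial"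
    "Graph_Theory.Graph_Theory"
begin

text \<open>
  A finite simple graph is a \<open>pair_graph\<close>: a finite, loop-free, symmetric set of vertex pairs.
\<close>

definition graph_dist :: "'a pair_pre_digraph \<Rightarrow> 'a \<Rightarrow> 'a \<Rightarrow> ereal" where
  "graph_dist G u v = wf_digraph.\<mu> (with_proj G) (\<lambda>_. 1) u v"

definition graph_power :: "'a pair_pre_digraph \<Rightarrow> nat \<Rightarrow> 'a pair_pre_digraph" where
  "graph_power G k = \<lparr> pverts = pverts G,
     parcs = {(u, v). u \<in> pverts G \<and> v \<in> pverts G \<and> u \<noteq> v \<and> graph_dist G u v \<le> ereal (real k)} \<rparr>"

definition independent_set :: "'a pair_pre_digraph \<Rightarrow> 'a set \<Rightarrow> bool" where
  "independent_set G S \<longleftrightarrow> S \<subseteq> pverts G \<and> (\<forall>u\<in>S. \<forall>v\<in>S. u \<noteq> v \<longrightarrow> (u, v) \<notin> parcs G)"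

definition independence_number :: "'a pair_pre_digraph \<Rightarrow> nat" where
  "independence_number G = (MAX S\<in>{S. independent_set G S}. card S)"

definition k_independent_set :: "nat \<Rightarrow> 'a pair_pre_digraph \<Rightarrow> 'a set \<Rightarrow> bool" where
  "k_independent_set k G S \<longleftrightarrow>
     S \<subseteq> pverts G \<and> (\<forall>u\<in>S. \<forall>v\<in>S. u \<noteq> v \<longrightarrow> graph_dist G u v > ereal (real k))"

definition k_independence_number :: "nat \<Rightarrow> 'a pair_pre_digraph \<Rightarrow> nat" where
  "k_independence_number k G = (MAX S\<in>{S. k_independent_set k G S}. card S)"

text \<open>
  The vertices of the \<open>m\<close>-fold strong product are the words of length \<open>m\<close> over the vertices.
\<close>

definition strong_power :: "'a pair_pre_digraph \<Rightarrow> nat \<Rightarrow> 'a list pair_pre_digraph" where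
  "strong_power H m =
     (let V = {xs. length xs = m \<and> set xs \<subseteq> pverts H} in
      \<lparr> pverts = V,
        parcs = {(xs, ys). xs \<in> V \<and> ys \<in> V \<and> xs \<noteq> ys \<and>
                   (\<forall>i<m. xs ! i = ys ! i \<or> (xs ! i, ys ! i) \<in> parcs H)} \<rparr>)"

definition shannon_capacity :: "'a pair_pre_digraph \<Rightarrow> real" where
  "shannon_capacity H = (SUP m\<in>{1..}. root m (real (independence_number (strong_power H m))))"

definition adjacency_matrix :: "'n::finite pair_pre_digraph \<Rightarrow> real^'n^'n" where
  "adjacency_matrix G = (\<chi> i j. if (i, j) \<in> parcs G then 1 else 0)"

text \<open>
  The operations \<open>*\<close> and \<open>^\<close> on \<open>real^'n^'n\<close> are componentwise, hence the separate matrix power.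
\<close>

primrec matrix_power :: "real^'n^'n \<Rightarrow> nat \<Rightarrow> real^'n^'n" where
  "matrix_power A 0 = mat 1"
| "matrix_power A (Suc i) = A ** matrix_power A i"

definition poly_matrix :: "real poly \<Rightarrow> real^'n^'n \<Rightarrow> real^'n^'n" where
  "poly_matrix p A = (\<Sum>i\<le>degree p. coeff p i *\<^sub>R matrix_power A i)"


text \<open>
  The maxima, the supremum and the minimum in the statement range over nonempty sets that are
  finite, respectively bounded, so \<open>Max\<close>, \<open>Sup\<close> and \<open>Min\<close> have their intended values.
\<close>

lemma graph_dist_sym:
  assumes "pair_graph G"
  shows "graph_dist G u v = graph_dist G v u"
proof -
  interpret pair_graph G by fact
  have cost: "awalk_cost (\<lambda>_. 1) (rev_path p) = awalk_cost (\<lambda>_. 1) p" for p :: "('a \<times> 'a) list"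
    by (induction p) auto
  have "graph_dist G a b \<le> graph_dist G b a" for a b
    unfolding graph_dist_def \<mu>_def
    by (rule INF_mono) (metis (no_types, lifting) awalk_rev_path cost mem_Collect_eq order_refl)
  then show ?thesis by (simp add: antisym)
qed

lemma pair_graph_graph_power:
  assumes "pair_graph G"
  shows "pair_graph (graph_power G k)"
proof -
  interpret pair_graph G by fact
  have fin: "finite (parcs (graph_power G k))"
    by (rule finite_subset[of _ "pverts G \<times> pverts G"])
      (use pair_finite_verts in \<open>auto simp: graph_power_def\<close>)
  show ?thesis
    using fin pair_finite_verts graph_dist_sym[OF assms]
    by unfold_locales (auto simp: graph_power_def symmetric_def sym_def)
qed

lemma pair_graph_strong_power:
  assumes "pair_graph H"
  shows "pair_graph (strong_power H m)"
proof -
  interpret pair_graph H by fact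
  have finV: "finite (pverts (strong_power H m))"
    using finite_lists_length_eq[OF pair_finite_verts, of m]
    by (simp add: strong_power_def conj_commute)
  have fin: "finite (parcs (strong_power H m))"
    by (rule finite_subset[OF _ finite_cartesian_product[OF finV finV]])
      (auto simp: strong_power_def Let_def)
  show ?thesis
    using fin finV
    by unfold_locales
      (auto simp: strong_power_def Let_def symmetric_def sym_def dest: arcs_symmetric; metis arcs_symmetric)+
qed

lemma independent_sets_finite_nonempty:
  assumes "pair_graph G"
  shows "finite {S. independent_set G S}" "{S. independent_set G S} \<noteq> {}"
    "finite {S. k_independent_set k G S}" "{S. k_independent_set k G S} \<noteq> {}"
proof -
  interpret pair_graph G by fact
  have fin: "finite (Pow (pverts G))" using pair_finite_verts by simp
  show "finite {S. independent_set G S}" "finite {S. k_independent_set k G S}"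
    by (rule finite_subset[OF _ fin], auto simp: independent_set_def k_independent_set_def)+
  have "independent_set G {}" "k_independent_set k G {}"
    by (auto simp: independent_set_def k_independent_set_def)
  then show "{S. independent_set G S} \<noteq> {}" "{S. k_independent_set k G S} \<noteq> {}"
    by blast+
qed

lemma independence_number_le_card:
  assumes "pair_graph G"
  shows "independence_number G \<le> card (pverts G)"
proof -
  interpret pair_graph G by fact
  show ?thesis
    unfolding independence_number_def
  proof (rule Max.boundedI)
    fix a assume "a \<in> card ` {S. independent_set G S}"
    then show "a \<le> card (pverts G)"
      using pair_finite_verts by (auto simp: independent_set_def intro: card_mono)
  qed (use independent_sets_finite_nonempty(1,2)[OF assms] in simp_all)
qed

lemma shannon_capacity_bdd_above:
  assumes "pair_graph H"
  shows "bdd_above ((\<lambda>m. root m (real (independence_number (strong_power H m)))) ` {1..})"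
proof (rule bdd_aboveI2)
  fix m :: nat assume m: "m \<in> {1..}"
  interpret pair_graph H by fact
  have "card (pverts (strong_power H m)) = card (pverts H) ^ m"
    using card_lists_length_eq[OF pair_finite_verts, of m]
    by (simp add: strong_power_def conj_commute)
  then have "independence_number (strong_power H m) \<le> card (pverts H) ^ m"
    using independence_number_le_card[OF pair_graph_strong_power[OF assms]] by metis
  then have "root m (real (independence_number (strong_power H m))) \<le> root m (real (card (pverts H)) ^ m)"
    using m by (intro real_root_le_mono) (auto simp flip: of_nat_power)
  also have "\<dots> = real (card (pverts H))"
    using m by (simp add: real_root_power_cancel)
  finally show "root m (real (independence_number (strong_power H m))) \<le> real (card (pverts H))" .
qed

lemma rank_set_finite_nonempty:
  fixes A :: "real^'n^'n" and k :: nat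
  defines "P \<equiv> {p. degree p \<le> k \<and> (\<forall>i. poly_matrix p A $ i $ i \<noteq> 0)}"
  shows "P \<noteq> {}" "finite ((\<lambda>p. rank (poly_matrix p A)) ` P)"
proof -
  have "1 \<in> P" by (simp add: P_def poly_matrix_def mat_def)
  then show "P \<noteq> {}" by blast
  show "finite ((\<lambda>p. rank (poly_matrix p A)) ` P)"
    by (rule finite_subset[of _ "{..CARD('n)}"]) (use rank_bound in \<open>force\<close>)+
qed

end

theory Submission
  imports Defs "HOL-Library.Function_Algebras"
begin

text \<open>
  The upper bound is Haemers' rank argument. Let \<open>M = p(A)\<close>. The entry \<open>(u, v)\<close> of \<open>A\<^sup>i\<close> counts
  walks of length \<open>i\<close>, so \<open>M\<close> has nonzero diagonal and vanishes at distinct vertices that are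
  nonadjacent in \<open>G\<^sup>k\<close>. On an independent set of the \<open>m\<close>-fold strong product, the
  \<open>m\<close>-fold Kronecker power of \<open>M\<close> is therefore a nonsingular diagonal matrix. Its columns are
  products of columns of \<open>M\<close>, hence they lie in the span of the \<open>(rank M)\<^sup>m\<close> products of elements
  of a basis of the column space of \<open>M\<close>.
\<close>

text \<open>Words form an infinite type, so vectors indexed by them are functions, with pointwise
  addition and this scaling.\<close>

lemma vector_space_fun: "vector_space (\<lambda>(c::'b::field) (f::'a \<Rightarrow> 'b) x. c * f x)"
  by unfold_locales (auto simp: fun_eq_iff algebra_simps)

text \<open>The columns of a nonsingular diagonal matrix are independent, and the factorization puts
  them in the span of the functions \<open>g t\<close>.\<close>

lemma card_le_of_diagonal_factorization:
  fixes D :: "'s \<Rightarrow> 's \<Rightarrow> 'b::field"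
  assumes fin: "finite T"
    and factor: "\<And>s s'. s \<in> S \<Longrightarrow> s' \<in> S \<Longrightarrow> D s s' = (\<Sum>t\<in>T. a s' t * g t s)"
    and diag: "\<And>s. s \<in> S \<Longrightarrow> D s s \<noteq> 0"
    and off: "\<And>s s'. s \<in> S \<Longrightarrow> s' \<in> S \<Longrightarrow> s \<noteq> s' \<Longrightarrow> D s s' = 0"
  shows "card S \<le> card T"
proof -
  interpret V: vector_space "\<lambda>(c::'b) (f::'s \<Rightarrow> 'b) x. c * f x"
    by (rule vector_space_fun)
  \<comment> \<open>\<open>F s'\<close> is column \<open>s'\<close> of \<open>D\<close> on
    \<open>S\<close>. Off \<open>S\<close> it is continued by the factorization, so it lies in the
    span as a function on the whole type.\<close>
  define F where "F s' = (\<Sum>t\<in>T. (\<lambda>x. a s' t * g t x))" for s'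
  have apply_sum: "(\<Sum>t\<in>U. h t) x = (\<Sum>t\<in>U. h t x)" for U :: "'t set" and h :: "'t \<Rightarrow> 's \<Rightarrow> 'b" and x
    by (induction U rule: infinite_finite_induct) auto
  have F: "F s' s = D s s'" if "s \<in> S" "s' \<in> S" for s s'
    using factor[OF that] by (simp add: F_def apply_sum)
  have inj: "inj_on F S"
    by (rule inj_onI) (metis F diag off)
  have "V.independent (F ` S)"
    unfolding V.dependent_def
  proof safe
    fix s assume s: "s \<in> S" and "F s \<in> V.span (F ` S - {F s})"
    \<comment> \<open>Functions vanishing at \<open>s\<close> form a subspace that contains every
      other column, but \<open>F s s\<close> is nonzero.\<close>
    moreover have "V.span (F ` S - {F s}) \<subseteq> {f. f s = 0}"
      by (rule V.span_minimal) (use s in \<open>auto simp: V.subspace_def F intro!: off\<close>)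
    ultimately show False
      using F diag s by auto
  qed
  moreover have "F ` S \<subseteq> V.span (g ` T)"
    unfolding F_def by (intro image_subsetI V.span_sum V.span_scale V.span_base imageI)
  ultimately have "card (F ` S) \<le> card (g ` T)"
    using V.independent_span_bound fin by blast
  then show ?thesis
    using card_image[OF inj] card_image_le[OF fin, of g] by simp
qed

text \<open>\<open>B\<close> is a basis of the column space and \<open>c j\<close> holds the
  coordinates of column \<open>j\<close>. Row and column index are thereby separated.\<close>

lemma rank_factorization:
  fixes M :: "real^'n^'m"
  obtains B :: "(real^'m) set" and c where "finite B" "card B = rank M"
    "\<And>i j. M $ i $ j = (\<Sum>b\<in>B. c j b * b $ i)"
proof -
  obtain B where B: "independent B" "columns M \<subseteq> span B" "card B = dim (columns M)"
    using basis_exists by blast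
  have fin: "finite B"
    using B(1) by (rule independent_imp_finite)
  have "\<exists>u. column j M = (\<Sum>b\<in>B. u b *\<^sub>R b)" for j
    using B(2) span_finite[OF fin] by (auto simp: columns_def)
  then obtain c where c: "\<And>j. column j M = (\<Sum>b\<in>B. c j b *\<^sub>R b)"
    by metis
  have "M $ i $ j = (\<Sum>b\<in>B. c j b * b $ i)" for i j
    using arg_cong[OF c[of j], of "\<lambda>v. v $ i"] by (simp add: column_def)
  then show thesis
    using that fin B(3) by (simp add: column_rank_def)
qed

lemma card_independent_strong_power_le_rank:
  fixes H :: "'n::finite pair_pre_digraph" and M :: "real^'n^'n"
  assumes diag: "\<And>i. M $ i $ i \<noteq> 0"
    and off: "\<And>u v. u \<in> pverts H \<Longrightarrow> v \<in> pverts H \<Longrightarrow> u \<noteq> v \<Longrightarrow> (u, v) \<notin> parcs H \<Longrightarrow> M $ u $ v = 0"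
    and S: "independent_set (strong_power H m) S"
  shows "card S \<le> rank M ^ m"
proof -
  obtain B :: "(real^'n) set" and c where B: "finite B" "card B = rank M"
    and M: "\<And>i j. M $ i $ j = (\<Sum>b\<in>B. c j b * b $ i)"
    using rank_factorization[of M] by blast
  define D where "D xs ys = (\<Prod>i<m. M $ (xs ! i) $ (ys ! i))" for xs ys
  have "card S \<le> card (\<Pi>\<^sub>E i\<in>{..<m}. B)"
  proof (rule card_le_of_diagonal_factorization)
    show "finite (\<Pi>\<^sub>E i\<in>{..<m}. B)"
      using B(1) by (simp add: finite_PiE)
    \<comment> \<open>Multiplying out the product of sums leaves one term per choice
      \<open>t\<close> of a basis vector in each coordinate.\<close>
    show "D xs ys = (\<Sum>t\<in>(\<Pi>\<^sub>E i\<in>{..<m}. B). (\<Prod>i<m. c (ys ! i) (t i)) * (\<Prod>i<m. t i $ (xs ! i)))"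
      for xs ys
      using B(1) by (simp add: D_def M prod_sum_PiE prod.distrib)
    show "D xs xs \<noteq> 0" for xs
      using diag by (simp add: D_def)
    show "D xs ys = 0" if xy: "xs \<in> S" "ys \<in> S" "xs \<noteq> ys" for xs ys
    proof -
      have V: "length xs = m" "length ys = m" "set xs \<subseteq> pverts H" "set ys \<subseteq> pverts H"
        using S xy by (auto simp: independent_set_def strong_power_def Let_def)
      have "(xs, ys) \<notin> parcs (strong_power H m)"
        using S xy by (auto simp: independent_set_def)
      \<comment> \<open>Distinct nonadjacent words have a coordinate with distinct nonadjacent
        letters; it contributes a zero factor.\<close>
      then obtain i where i: "i < m" "xs ! i \<noteq> ys ! i" "(xs ! i, ys ! i) \<notin> parcs H"
        using V xy by (auto simp: strong_power_def Let_def)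
      then have "M $ (xs ! i) $ (ys ! i) = 0"
        using V by (intro off) auto
      then show ?thesis
        using i(1) by (auto simp: D_def)
    qed
  qed
  then show ?thesis
    by (simp add: card_PiE B)
qed

text \<open>The bound on independent sets is an \<open>m\<close>-th power, so \<open>rank M\<close>
  bounds every root. This is Haemers' bound for any real matrix that fits \<open>H\<close>.\<close>

theorem shannon_capacity_le_rank:
  fixes H :: "'n::finite pair_pre_digraph" and M :: "real^'n^'n"
  assumes H: "pair_graph H"
    and diag: "\<And>i. M $ i $ i \<noteq> 0"
    and off: "\<And>u v. u \<in> pverts H \<Longrightarrow> v \<in> pverts H \<Longrightarrow> u \<noteq> v \<Longrightarrow> (u, v) \<notin> parcs H \<Longrightarrow> M $ u $ v = 0"
  shows "shannon_capacity H \<le> real (rank M)"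
  unfolding shannon_capacity_def
proof (rule cSUP_least)
  fix m :: nat assume m: "m \<in> {1..}"
  have "independence_number (strong_power H m) \<le> rank M ^ m"
    unfolding independence_number_def
    using independent_sets_finite_nonempty(1,2)[OF pair_graph_strong_power[OF H, of m]]
      card_independent_strong_power_le_rank[OF diag off]
    by (intro Max.boundedI) auto
  then have "root m (real (independence_number (strong_power H m))) \<le> root m (real (rank M) ^ m)"
    using m by (intro real_root_le_mono) (auto simp flip: of_nat_power)
  also have "\<dots> = real (rank M)"
    using m by (simp add: real_root_power_cancel)
  finally show "root m (real (independence_number (strong_power H m))) \<le> real (rank M)" .
qed simp

text \<open>The term for \<open>m = 1\<close> suffices: one-letter words give a copy of
  \<open>H\<close>.\<close>

lemma independence_number_le_shannon_capacity:
  assumes H: "pair_graph H"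
  shows "real (independence_number H) \<le> shannon_capacity H"
proof -
  obtain S where S: "independent_set H S" "card S = independence_number H"
    using obtains_MAX[OF independent_sets_finite_nonempty(1,2)[OF H], of card]
    unfolding independence_number_def by (metis mem_Collect_eq)
  let ?S = "(\<lambda>x. [x]) ` S"
  have "independent_set (strong_power H 1) ?S"
    using S(1) by (auto simp: independent_set_def strong_power_def)
  then have "card ?S \<le> independence_number (strong_power H 1)"
    unfolding independence_number_def
    using independent_sets_finite_nonempty(1)[OF pair_graph_strong_power[OF H, of 1]]
    by (intro Max_ge) auto
  moreover have "card ?S = card S"
    by (rule card_image) (simp add: inj_on_def)
  ultimately have "real (independence_number H) \<le> root 1 (real (independence_number (strong_power H 1)))"
    using S(2) by simp
  \<comment> \<open>A real supremum dominates its terms once the family is known to be bounded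
    above.\<close>
  also have "\<dots> \<le> shannon_capacity H"
    unfolding shannon_capacity_def
    by (rule cSUP_upper[OF _ shannon_capacity_bdd_above[OF H]]) simp
  finally show ?thesis .
qed

lemma k_independent_set_iff_independent_set_graph_power:
  "k_independent_set k G S \<longleftrightarrow> independent_set (graph_power G k) S"
  by (auto simp: k_independent_set_def independent_set_def graph_power_def not_le)

lemma k_independence_number_eq:
  "k_independence_number k G = independence_number (graph_power G k)"
  by (simp add: k_independence_number_def independence_number_def
      k_independent_set_iff_independent_set_graph_power)

text \<open>A nonzero entry yields a walk of length exactly \<open>i\<close>, whose unit cost bounds
  the distance. For \<open>i = 0\<close> the empty walk must sit at a vertex of
  \<open>G\<close>.\<close>

lemma graph_dist_le_of_matrix_power_nonzero:
  assumes G: "pair_graph G" and "v \<in> pverts G"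
    and "matrix_power (adjacency_matrix G) i $ u $ v \<noteq> 0"
  shows "graph_dist G u v \<le> ereal (real i)"
proof -
  interpret pair_graph G by fact
  have "\<exists>p. awalk u p v \<and> length p = i"
    using assms(3)
  proof (induction i arbitrary: u)
    case 0
    then have "u = v"
      by (auto simp: mat_def split: if_splits)
    then show ?case
      using \<open>v \<in> pverts G\<close> by (auto simp: awalk_Nil_iff)
  next
    case (Suc i)
    \<comment> \<open>Some summand of the matrix product is nonzero; its index \<open>w\<close> is
      the second vertex of the walk.\<close>
    then obtain w where w: "(u, w) \<in> parcs G" "matrix_power (adjacency_matrix G) i $ w $ v \<noteq> 0"
      by (auto simp: matrix_matrix_mult_def adjacency_matrix_def elim!: sum.not_neutral_contains_not_neutral
          split: if_splits)
    then obtain p where "awalk w p v" "length p = i"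
      using Suc.IH by blast
    then have "awalk u ((u, w) # p) v \<and> length ((u, w) # p) = Suc i"
      using w(1) by (auto simp: awalk_Cons_iff)
    then show ?case
      by blast
  qed
  then obtain p where p: "awalk u p v" "length p = i"
    by blast
  have "awalk_cost (\<lambda>_. 1) p = real (length p)"
    by (induction p) auto
  then show ?thesis
    using min_cost_le_walk_cost[OF p(1), of "\<lambda>_. 1"] p(2) by (simp add: graph_dist_def)
qed

text \<open>Only powers up to \<open>k\<close> occur in \<open>p(A)\<close>, and none of them
  reaches a vertex at distance greater than \<open>k\<close>.\<close>

lemma poly_matrix_eq_0_of_not_adjacent_graph_power:
  assumes G: "pair_graph G" and p: "degree p \<le> k"
    and uv: "u \<in> pverts G" "v \<in> pverts G" "u \<noteq> v" "(u, v) \<notin> parcs (graph_power G k)"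
  shows "poly_matrix p (adjacency_matrix G) $ u $ v = 0"
proof -
  have "matrix_power (adjacency_matrix G) i $ u $ v = 0" if "i \<le> degree p" for i
  proof (rule ccontr)
    assume "matrix_power (adjacency_matrix G) i $ u $ v \<noteq> 0"
    then have "graph_dist G u v \<le> ereal (real i)"
      by (rule graph_dist_le_of_matrix_power_nonzero[OF G uv(2)])
    also have "\<dots> \<le> ereal (real k)"
      using that p by simp
    finally show False
      using uv by (simp add: graph_power_def)
  qed
  then show ?thesis
    by (simp add: poly_matrix_def)
qed

theorem theorem4p2:
  fixes G :: "'n::finite pair_pre_digraph" and A :: "real^'n^'n" and k :: nat
  assumes "pair_graph G"
    and "pverts G = UNIV"
    and "Digraph_Component.connected (with_proj G)"
    and "A = adjacency_matrix G"
    and "k > 0"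
  shows "k_independence_number k G = independence_number (graph_power G k)
    \<and> real (independence_number (graph_power G k)) \<le> shannon_capacity (graph_power G k)
    \<and> shannon_capacity (graph_power G k)
        \<le> real (MIN p\<in>{p. degree p \<le> k \<and> (\<forall>i. poly_matrix p A $ i $ i \<noteq> 0)}. rank (poly_matrix p A))"
proof (intro conjI)
  let ?P = "{p. degree p \<le> k \<and> (\<forall>i. poly_matrix p A $ i $ i \<noteq> 0)}"
  have H: "pair_graph (graph_power G k)"
    using assms(1) by (rule pair_graph_graph_power)
  show "k_independence_number k G = independence_number (graph_power G k)"
    by (rule k_independence_number_eq)
  show "real (independence_number (graph_power G k)) \<le> shannon_capacity (graph_power G k)"
    using H by (rule independence_number_le_shannon_capacity)
  \<comment> \<open>The ranks form a finite nonempty set, so some \<open>p\<close> attains the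
    minimum and only this \<open>p\<close> has to be treated.\<close>
  have "(MIN p\<in>?P. rank (poly_matrix p A)) \<in> (\<lambda>p. rank (poly_matrix p A)) ` ?P"
    using rank_set_finite_nonempty[where A = A and k = k] by (intro Min_in) auto
  then obtain p where p: "p \<in> ?P" "(MIN p\<in>?P. rank (poly_matrix p A)) = rank (poly_matrix p A)"
    by blast
  have "shannon_capacity (graph_power G k) \<le> real (rank (poly_matrix p A))"
  proof (rule shannon_capacity_le_rank[OF H])
    show "poly_matrix p A $ i $ i \<noteq> 0" for i
      using p(1) by simp
    \<comment> \<open>Every index is a vertex, because \<open>pverts G = UNIV\<close>.\<close>
    show "poly_matrix p A $ u $ v = 0" if "u \<noteq> v" "(u, v) \<notin> parcs (graph_power G k)" for u v
      using poly_matrix_eq_0_of_not_adjacent_graph_power[OF assms(1), of p k u v] p(1) that assms(2,4)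
      by simp
  qed
  then show "shannon_capacity (graph_power G k) \<le> real (MIN p\<in>?P. rank (poly_matrix p A))"
    using p(2) by simp
qed

end
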